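(* Let $S=\mathscr{M}[G;I,\Lambda;P]$ be a completely simple semigroup and let $\gamma_1=(\bar\gamma_1,\lambda_k)$, $\gamma_2=(\bar\gamma_2,\lambda_l)\in T\mathcal{L}(S)$. Then $\gamma_1\,\mathscr{R}\,\gamma_2$ (Green's relation in $T\mathcal{L}(S)$) if and only if $\bar\gamma_1G=\bar\gamma_2G$.
   Context: $G$ is a group, $I,\Lambda$ are nonempty sets, $P=(p_{\lambda i})$ is a $\Lambda\times I$ matrix over $G$, and $S=\mathscr{M}[G;I,\Lambda;P]=G\times I\times\Lambda$ with product $(a,i,\lambda)(b,j,\mu)=(ap_{\lambda j}b,i,\mu)$. Category $\mathcal{L}(S)$ (composition written left to right): objects are the principal left ideals of $S$, namely $\bar\lambda=G\times I\times\{\lambda\}$, $\lambda\in\Lambda$; the morphisms $\bar\lambda_1\to\bar\lambda_2$ are the (partial) right translations, namely the maps $\rho(g):(h,i,\lambda_1)\mapsto(hg,i,\lambda_2)$, $g\in G$. All morphisms are isomorphisms and the only inclusions are identities. A normal cone $\gamma$ in $\mathcal{L}(S)$ with vertex $\bar\lambda$ is a choice of morphisms $\gamma(\bar\mu):\bar\mu\to\bar\lambda$ for all $\mu\in\Lambda$; it is identified with $(\bar\gamma,\lambda)\in G^\Lambda\times\Lambda$ where $\gamma(\bar\mu)=\rho(\bar\gamma(\mu))$. $T\mathcal{L}(S)$ is the semigroup of all normal cones with product $(\gamma_1\ast\gamma_2)(\bar\mu)=\gamma_1(\bar\mu)\gamma_2(c_{\gamma_1})$, $c_{\gamma_1}$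 being the vertex of $\gamma_1$; in coordinates $(\bar\gamma_1,\lambda_k)\ast(\bar\gamma_2,\lambda_l)=(\bar\gamma_1\cdot\bar g_k,\lambda_l)$, where $g_k=\bar\gamma_2(\lambda_k)$ and $\bar g_k=(g_k,g_k,\dots)\in G^\Lambda$. $G$ is regarded as the subgroup of constant functions in the group $G^\Lambda$ (pointwise product), and $\bar\gamma G=\{\bar\gamma\cdot(g,g,\dots):g\in G\}$ is a left coset of $G$ in $G^\Lambda$. *)

theory Defs
  imports "HOL-Algebra.Coset" "HOL-Algebra.Product_Groups"
begin

record 'a sgrp = "'a partial_object" +
  sg_mult :: "['a, 'a] \<Rightarrow> 'a" (infixl \<open>\<star>\<index>\<close> 70)

text \<open>Adding the generator to the set of its multiples gives the ideal generated in the
  semigroup with an identity adjoined.\<close>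

definition principal_left_ideal :: "('a, 'm) sgrp_scheme \<Rightarrow> 'a \<Rightarrow> 'a set" where
  "principal_left_ideal S x = insert x {s \<star>\<^bsub>S\<^esub> x | s. s \<in> carrier S}"

definition principal_right_ideal :: "('a, 'm) sgrp_scheme \<Rightarrow> 'a \<Rightarrow> 'a set" where
  "principal_right_ideal S x = insert x {x \<star>\<^bsub>S\<^esub> s | s. s \<in> carrier S}"

definition green_R :: "('a, 'm) sgrp_scheme \<Rightarrow> ('a \<times> 'a) set" where
  "green_R S = {(x, y). x \<in> carrier S \<and> y \<in> carrier S \<and>
     principal_right_ideal S x = principal_right_ideal S y}"

definition rees :: "('g, 'm) monoid_scheme \<Rightarrow> 'i set \<Rightarrow> 'l set \<Rightarrow> ('l \<Rightarrow> 'i \<Rightarrow> 'g)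
    \<Rightarrow> ('g \<times> 'i \<times> 'l) sgrp" where
  "rees G I \<Lambda> P = \<lparr>carrier = carrier G \<times> I \<times> \<Lambda>,
     sg_mult = (\<lambda>(a, i, l) (b, j, m). (a \<otimes>\<^bsub>G\<^esub> P l j \<otimes>\<^bsub>G\<^esub> b, i, m))\<rparr>"

definition lbar :: "('g, 'm) monoid_scheme \<Rightarrow> 'i set \<Rightarrow> 'l \<Rightarrow> ('g \<times> 'i \<times> 'l) set" where
  "lbar G I l = carrier G \<times> I \<times> {l}"

definition rho :: "('g, 'm) monoid_scheme \<Rightarrow> 'i set \<Rightarrow> 'l \<Rightarrow> 'l \<Rightarrow> 'g
    \<Rightarrow> 'g \<times> 'i \<times> 'l \<Rightarrow> 'g \<times> 'i \<times> 'l" where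
  "rho G I l1 l2 g = restrict (\<lambda>(h, i, l). (h \<otimes>\<^bsub>G\<^esub> g, i, l2)) (lbar G I l1)"

definition L_obj :: "('g, 'm) monoid_scheme \<Rightarrow> 'i set \<Rightarrow> 'l set \<Rightarrow> ('l \<Rightarrow> 'i \<Rightarrow> 'g)
    \<Rightarrow> ('g \<times> 'i \<times> 'l) set set" where
  "L_obj G I \<Lambda> P = principal_left_ideal (rees G I \<Lambda> P) ` carrier (rees G I \<Lambda> P)"

definition L_hom :: "('g, 'm) monoid_scheme \<Rightarrow> 'i set \<Rightarrow> 'l set
    \<Rightarrow> ('g \<times> 'i \<times> 'l) set \<Rightarrow> ('g \<times> 'i \<times> 'l) set
    \<Rightarrow> ('g \<times> 'i \<times> 'l \<Rightarrow> 'g \<times> 'i \<times> 'l) set" where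
  "L_hom G I \<Lambda> A B = {rho G I l1 l2 g | l1 l2 g.
     l1 \<in> \<Lambda> \<and> l2 \<in> \<Lambda> \<and> g \<in> carrier G \<and> A = lbar G I l1 \<and> B = lbar G I l2}"

record 'a cone =
  component :: "'a set \<Rightarrow> 'a \<Rightarrow> 'a"
  vertex :: "'a set"

text \<open>In this category every morphism is an isomorphism and the only inclusions are
  identities, so a normal cone is an arbitrary family of morphisms into the vertex.
  Components are extensional, so that equal cones are equal as records.\<close>

definition normal_cones :: "('g, 'm) monoid_scheme \<Rightarrow> 'i set \<Rightarrow> 'l set \<Rightarrow> ('l \<Rightarrow> 'i \<Rightarrow> 'g)
    \<Rightarrow> ('g \<times> 'i \<times> 'l) cone set" where
  "normal_cones G I \<Lambda> P = {\<gamma>. vertex \<gamma> \<in> L_obj G I \<Lambda> P \<and>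
     component \<gamma> \<in> (\<Pi>\<^sub>E A\<in>L_obj G I \<Lambda> P. L_hom G I \<Lambda> A (vertex \<gamma>))}"

text \<open>The categorical composite is written left to right, so \<open>compose\<close> applies
  the component of the first cone first.\<close>

definition TL :: "('g, 'm) monoid_scheme \<Rightarrow> 'i set \<Rightarrow> 'l set \<Rightarrow> ('l \<Rightarrow> 'i \<Rightarrow> 'g)
    \<Rightarrow> ('g \<times> 'i \<times> 'l) cone sgrp" where
  "TL G I \<Lambda> P = \<lparr>carrier = normal_cones G I \<Lambda> P,
     sg_mult = (\<lambda>\<gamma>1 \<gamma>2.
       \<lparr>component = (\<lambda>A\<in>L_obj G I \<Lambda> P.
          compose A (component \<gamma>2 (vertex \<gamma>1)) (component \<gamma>1 A)),
        vertex = vertex \<gamma>2\<rparr>)\<rparr>"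

text \<open>The identification of the cone \<open>\<gamma>\<close> with the pair \<open>(c, l)\<close>.\<close>

definition cone_coords :: "('g, 'm) monoid_scheme \<Rightarrow> 'i set \<Rightarrow> 'l set
    \<Rightarrow> ('g \<times> 'i \<times> 'l) cone \<Rightarrow> ('l \<Rightarrow> 'g) \<Rightarrow> 'l \<Rightarrow> bool" where
  "cone_coords G I \<Lambda> \<gamma> c l \<longleftrightarrow> vertex \<gamma> = lbar G I l \<and>
     (\<forall>\<mu>\<in>\<Lambda>. component \<gamma> (lbar G I \<mu>) = rho G I \<mu> l (c \<mu>))"

abbreviation power_group :: "('g, 'm) monoid_scheme \<Rightarrow> 'l set \<Rightarrow> ('l \<Rightarrow> 'g) monoid" where
  "power_group G \<Lambda> \<equiv> product_group \<Lambda> (\<lambda>_. G)"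

definition const_subgroup :: "('g, 'm) monoid_scheme \<Rightarrow> 'l set \<Rightarrow> ('l \<Rightarrow> 'g) set" where
  "const_subgroup G \<Lambda> = {(\<lambda>_\<in>\<Lambda>. g) | g. g \<in> carrier G}"

lemma subgroup_const:
  assumes "group G"
  shows "subgroup (const_subgroup G \<Lambda>) (power_group G \<Lambda>)"
proof -
  interpret group G by fact
  interpret P: group "power_group G \<Lambda>" by (simp add: assms product_group)
  show ?thesis
  proof (rule P.subgroupI)
    show "const_subgroup G \<Lambda> \<subseteq> carrier (power_group G \<Lambda>)"
      by (auto simp: const_subgroup_def)
    show "const_subgroup G \<Lambda> \<noteq> {}" by (auto simp: const_subgroup_def)
  next
    fix a assume "a \<in> const_subgroup G \<Lambda>"
    then obtain g where g: "g \<in> carrier G" "a = (\<lambda>_\<in>\<Lambda>. g)" by (auto simp: const_subgroup_def)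
    have "inv\<^bsub>power_group G \<Lambda>\<^esub> a = (\<lambda>_\<in>\<Lambda>. inv\<^bsub>G\<^esub> g)"
      using g by (subst inv_product_group) (auto simp: assms intro!: restrict_ext)
    then show "inv\<^bsub>power_group G \<Lambda>\<^esub> a \<in> const_subgroup G \<Lambda>"
      using g by (auto simp: const_subgroup_def)
  next
    fix a b assume "a \<in> const_subgroup G \<Lambda>" "b \<in> const_subgroup G \<Lambda>"
    then obtain g h where "g \<in> carrier G" "a = (\<lambda>_\<in>\<Lambda>. g)" "h \<in> carrier G" "b = (\<lambda>_\<in>\<Lambda>. h)"
      by (auto simp: const_subgroup_def)
    then have "a \<otimes>\<^bsub>power_group G \<Lambda>\<^esub> b = (\<lambda>_\<in>\<Lambda>. g \<otimes>\<^bsub>G\<^esub> h)" "g \<otimes>\<^bsub>G\<^esub> h \<in> carrier G"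
      by (auto intro!: restrict_ext)
    then show "a \<otimes>\<^bsub>power_group G \<Lambda>\<^esub> b \<in> const_subgroup G \<Lambda>"
      unfolding const_subgroup_def by blast
  qed
qed

lemma principal_left_ideal_rees:
  assumes "group G" and P: "\<And>l i. l \<in> \<Lambda> \<Longrightarrow> i \<in> I \<Longrightarrow> P l i \<in> carrier G"
    and x: "a \<in> carrier G" "i \<in> I" "l \<in> \<Lambda>"
  shows "principal_left_ideal (rees G I \<Lambda> P) (a, i, l) = lbar G I l"
proof -
  interpret group G by fact
  have "\<exists>b m. (h, j, l) = (b \<otimes>\<^bsub>G\<^esub> P m i \<otimes>\<^bsub>G\<^esub> a, j, l) \<and> b \<in> carrier G \<and> m \<in> \<Lambda>"
    if h: "h \<in> carrier G" for h and j :: 'b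
  proof -
    have "h = (h \<otimes>\<^bsub>G\<^esub> inv\<^bsub>G\<^esub> (P l i \<otimes>\<^bsub>G\<^esub> a)) \<otimes>\<^bsub>G\<^esub> P l i \<otimes>\<^bsub>G\<^esub> a"
      using h x P[OF x(3,2)] by (simp add: m_assoc)
    then show ?thesis using h x P[OF x(3,2)] by (metis inv_closed m_closed)
  qed
  then have "lbar G I l \<subseteq> principal_left_ideal (rees G I \<Lambda> P) (a, i, l)"
    unfolding principal_left_ideal_def rees_def lbar_def by force
  moreover have "principal_left_ideal (rees G I \<Lambda> P) (a, i, l) \<subseteq> lbar G I l"
    using x P by (auto simp: principal_left_ideal_def rees_def lbar_def)
  ultimately show ?thesis by blast
qed

lemma L_obj_eq:
  assumes "group G" "I \<noteq> {}" and P: "\<And>l i. l \<in> \<Lambda> \<Longrightarrow> i \<in> I \<Longrightarrow> P l i \<in> carrier G"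
  shows "L_obj G I \<Lambda> P = lbar G I ` \<Lambda>"
proof -
  interpret group G by fact
  obtain i where i: "i \<in> I" using assms by blast
  have eq: "principal_left_ideal (rees G I \<Lambda> P) (a, j, l) = lbar G I l"
    if "a \<in> carrier G" "j \<in> I" "l \<in> \<Lambda>" for a j l
    using principal_left_ideal_rees[where P = P] assms that by blast
  have "lbar G I l \<in> L_obj G I \<Lambda> P" if "l \<in> \<Lambda>" for l
    unfolding L_obj_def
    by (rule image_eqI[of _ _ "(\<one>\<^bsub>G\<^esub>, i, l)"]) (use i that eq in \<open>auto simp: rees_def\<close>)
  moreover have "L_obj G I \<Lambda> P \<subseteq> lbar G I ` \<Lambda>"
    using eq by (auto simp: L_obj_def rees_def)
  ultimately show ?thesis by auto
qed

lemma lbar_inject: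
  assumes "group G" "I \<noteq> {}" shows "lbar G I l = lbar G I m \<longleftrightarrow> l = m"
proof -
  interpret group G by fact
  show ?thesis using assms one_closed unfolding lbar_def by blast
qed

text \<open>The morphisms are exactly the restrictions of right translations of the semigroup.\<close>

lemma L_hom_right_translations:
  assumes "group G" "I \<noteq> {}" and P: "\<And>l i. l \<in> \<Lambda> \<Longrightarrow> i \<in> I \<Longrightarrow> P l i \<in> carrier G"
    and l: "l1 \<in> \<Lambda>" "l2 \<in> \<Lambda>"
  shows "L_hom G I \<Lambda> (lbar G I l1) (lbar G I l2) =
    {restrict (\<lambda>x. x \<star>\<^bsub>rees G I \<Lambda> P\<^esub> u) (lbar G I l1) | u. u \<in> lbar G I l2}" (is "?L = ?R")
proof -
  interpret group G by fact
  obtain i where i: "i \<in> I" using assms by blast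
  have tr: "restrict (\<lambda>x. x \<star>\<^bsub>rees G I \<Lambda> P\<^esub> (b, j, l2)) (lbar G I l1)
      = rho G I l1 l2 (P l1 j \<otimes>\<^bsub>G\<^esub> b)" if "b \<in> carrier G" "j \<in> I" for b j
    unfolding rho_def
    by (rule restrict_ext) (use that P l in \<open>auto simp: rees_def lbar_def m_assoc\<close>)
  have L: "?L = rho G I l1 l2 ` carrier G"
    using l by (auto simp: L_hom_def lbar_inject[OF assms(1,2)])
  have 1: "rho G I l1 l2 g \<in> ?R" if g: "g \<in> carrier G" for g
  proof -
    have c: "inv\<^bsub>G\<^esub> (P l1 i) \<otimes>\<^bsub>G\<^esub> g \<in> carrier G" using g P[OF l(1) i] by simp
    have "P l1 i \<otimes>\<^bsub>G\<^esub> (inv\<^bsub>G\<^esub> (P l1 i) \<otimes>\<^bsub>G\<^esub> g) = g"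
      using g P[OF l(1) i] by (simp add: m_assoc[symmetric])
    with tr[OF c i] have "rho G I l1 l2 g =
        restrict (\<lambda>x. x \<star>\<^bsub>rees G I \<Lambda> P\<^esub> (inv\<^bsub>G\<^esub> (P l1 i) \<otimes>\<^bsub>G\<^esub> g, i, l2)) (lbar G I l1)"
      by simp
    then show ?thesis using c i by (auto simp: lbar_def)
  qed
  have 2: "?R \<subseteq> rho G I l1 l2 ` carrier G"
  proof
    fix f assume "f \<in> ?R"
    then obtain b j where b: "b \<in> carrier G" "j \<in> I"
      and f: "f = restrict (\<lambda>x. x \<star>\<^bsub>rees G I \<Lambda> P\<^esub> (b, j, l2)) (lbar G I l1)"
      by (auto simp: lbar_def)
    then show "f \<in> rho G I l1 l2 ` carrier G" using tr[OF b] P[OF l(1) b(2)] by auto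
  qed
  show ?thesis unfolding L by (intro subset_antisym image_subsetI 1 2)
qed

lemma rho_inject:
  assumes "group G" "I \<noteq> {}" "g \<in> carrier G" "h \<in> carrier G"
    and "rho G I l m g = rho G I l m h"
  shows "g = h"
proof -
  interpret group G by fact
  obtain i where i: "i \<in> I" using assms by blast
  have "rho G I l m g (\<one>\<^bsub>G\<^esub>, i, l) = rho G I l m h (\<one>\<^bsub>G\<^esub>, i, l)" using assms by simp
  then show ?thesis using i assms by (auto simp: rho_def lbar_def)
qed

lemma cone_coords_ex1:
  assumes "group G" "I \<noteq> {}" and P: "\<And>l i. l \<in> \<Lambda> \<Longrightarrow> i \<in> I \<Longrightarrow> P l i \<in> carrier G"
    and \<gamma>: "\<gamma> \<in> carrier (TL G I \<Lambda> P)"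
  shows "\<exists>!(c, l). c \<in> carrier (power_group G \<Lambda>) \<and> l \<in> \<Lambda> \<and> cone_coords G I \<Lambda> \<gamma> c l"
proof -
  note obj = L_obj_eq[OF assms(1,2), of \<Lambda> P, OF P]
  obtain l where l: "l \<in> \<Lambda>" "vertex \<gamma> = lbar G I l"
    using \<gamma> obj by (auto simp: TL_def normal_cones_def)
  have "\<exists>g. g \<in> carrier G \<and> component \<gamma> (lbar G I \<mu>) = rho G I \<mu> l g" if \<mu>: "\<mu> \<in> \<Lambda>" for \<mu>
  proof -
    have "component \<gamma> (lbar G I \<mu>) \<in> L_hom G I \<Lambda> (lbar G I \<mu>) (lbar G I l)"
      using \<gamma> obj l \<mu> by (auto simp: TL_def normal_cones_def)
    then show ?thesis by (auto simp: L_hom_def lbar_inject[OF assms(1,2)])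
  qed
  then obtain f where f: "\<And>\<mu>. \<mu> \<in> \<Lambda> \<Longrightarrow> f \<mu> \<in> carrier G \<and>
      component \<gamma> (lbar G I \<mu>) = rho G I \<mu> l (f \<mu>)" by metis
  show ?thesis
  proof (rule ex1I[of _ "(restrict f \<Lambda>, l)"], goal_cases)
    case 1
    show ?case using f l by (auto simp: cone_coords_def)
  next
    case (2 y)
    obtain c m where y: "y = (c, m)" by (cases y)
    have c: "c \<in> carrier (power_group G \<Lambda>)" "cone_coords G I \<Lambda> \<gamma> c m" using 2 y by auto
    then have m: "m = l" using l lbar_inject[OF assms(1,2), of l m] by (simp add: cone_coords_def)
    have "c \<mu> = restrict f \<Lambda> \<mu>" if \<mu>: "\<mu> \<in> \<Lambda>" for \<mu>
    proof -
      have "c \<mu> \<in> carrier G" using c \<mu> by auto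
      moreover have "rho G I \<mu> l (c \<mu>) = rho G I \<mu> l (f \<mu>)"
        using c m f[OF \<mu>] \<mu> by (auto simp: cone_coords_def)
      ultimately show ?thesis using rho_inject[OF assms(1,2)] f[OF \<mu>] \<mu> by auto
    qed
    moreover have "c \<in> extensional \<Lambda>" using c by (simp add: PiE_def)
    ultimately have "c = restrict f \<Lambda>" by (intro extensionalityI[of _ \<Lambda>]) auto
    then show ?case using y m by simp
  qed
qed

lemma cone_ex1:
  assumes "group G" "I \<noteq> {}" and P: "\<And>l i. l \<in> \<Lambda> \<Longrightarrow> i \<in> I \<Longrightarrow> P l i \<in> carrier G"
    and c: "c \<in> carrier (power_group G \<Lambda>)" and l: "l \<in> \<Lambda>"
  shows "\<exists>!\<gamma>. \<gamma> \<in> carrier (TL G I \<Lambda> P) \<and> cone_coords G I \<Lambda> \<gamma> c l"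
proof -
  note obj = L_obj_eq[OF assms(1,2), of \<Lambda> P, OF P]
  note inj = lbar_inject[OF assms(1,2)]
  let ?f = "\<lambda>A\<in>L_obj G I \<Lambda> P. (let \<mu> = (THE \<mu>. A = lbar G I \<mu>) in rho G I \<mu> l (c \<mu>))"
  have f: "?f (lbar G I \<mu>) = rho G I \<mu> l (c \<mu>)" if "\<mu> \<in> \<Lambda>" for \<mu>
    using that by (simp add: obj inj)
  have mem: "rho G I \<mu> l (c \<mu>) \<in> L_hom G I \<Lambda> (lbar G I \<mu>) (lbar G I l)" if "\<mu> \<in> \<Lambda>" for \<mu>
  proof -
    have "c \<mu> \<in> carrier G" using c that by auto
    then show ?thesis using that l unfolding L_hom_def by blast
  qed
  have F: "?f \<in> (\<Pi>\<^sub>E A\<in>L_obj G I \<Lambda> P. L_hom G I \<Lambda> A (lbar G I l))"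
  proof (rule PiE_I)
    fix A assume "A \<in> L_obj G I \<Lambda> P"
    then obtain \<mu> where \<mu>: "\<mu> \<in> \<Lambda>" "A = lbar G I \<mu>" using obj by blast
    show "?f A \<in> L_hom G I \<Lambda> A (lbar G I l)"
      unfolding \<mu>(2) f[OF \<mu>(1)] by (rule mem[OF \<mu>(1)])
  qed simp
  show ?thesis
  proof (rule ex1I[of _ "\<lparr>component = ?f, vertex = lbar G I l\<rparr>"], goal_cases)
    case 1
    have "lbar G I l \<in> L_obj G I \<Lambda> P" using l obj by auto
    then show ?case using F f by (simp add: TL_def normal_cones_def cone_coords_def)
  next
    case (2 \<gamma>)
    then have \<gamma>: "vertex \<gamma> = lbar G I l" "component \<gamma> \<in> extensional (L_obj G I \<Lambda> P)"
      "\<And>\<mu>. \<mu> \<in> \<Lambda> \<Longrightarrow> component \<gamma> (lbar G I \<mu>) = rho G I \<mu> l (c \<mu>)"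
      by (auto simp: TL_def normal_cones_def cone_coords_def PiE_def)
    have "component \<gamma> = ?f"
    proof (rule extensionalityI[OF \<gamma>(2)])
      fix A assume "A \<in> L_obj G I \<Lambda> P"
      then obtain \<mu> where \<mu>: "\<mu> \<in> \<Lambda>" "A = lbar G I \<mu>" using obj by blast
      show "component \<gamma> A = ?f A"
        unfolding \<mu>(2) f[OF \<mu>(1)] by (rule \<gamma>(3)[OF \<mu>(1)])
    qed simp
    then show ?case using \<gamma>(1) by simp
  qed
qed

lemma cone_coords_mult:
  assumes "group G" "I \<noteq> {}" and P: "\<And>l i. l \<in> \<Lambda> \<Longrightarrow> i \<in> I \<Longrightarrow> P l i \<in> carrier G"
    and c: "c1 \<in> carrier (power_group G \<Lambda>)" "c2 \<in> carrier (power_group G \<Lambda>)"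
    and l: "k \<in> \<Lambda>" "l \<in> \<Lambda>"
    and \<gamma>: "cone_coords G I \<Lambda> \<gamma>1 c1 k" "cone_coords G I \<Lambda> \<gamma>2 c2 l"
  shows "cone_coords G I \<Lambda> (\<gamma>1 \<star>\<^bsub>TL G I \<Lambda> P\<^esub> \<gamma>2)
    (c1 \<otimes>\<^bsub>power_group G \<Lambda>\<^esub> (\<lambda>_\<in>\<Lambda>. c2 k)) l"
proof -
  interpret group G by fact
  note obj = L_obj_eq[OF assms(1,2), of \<Lambda> P, OF P]
  have "compose (lbar G I \<mu>) (rho G I k l (c2 k)) (rho G I \<mu> k (c1 \<mu>))
      = rho G I \<mu> l (c1 \<mu> \<otimes>\<^bsub>G\<^esub> c2 k)" if "\<mu> \<in> \<Lambda>" for \<mu>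
  proof -
    have "c1 \<mu> \<in> carrier G" "c2 k \<in> carrier G" using c l that by auto
    then show ?thesis
      by (auto simp: compose_def rho_def lbar_def m_assoc fun_eq_iff restrict_def)
  qed
  then show ?thesis using \<gamma> l obj by (auto simp: cone_coords_def TL_def)
qed

end

theory Submission
  imports Defs
begin

text \<open>In coordinates, multiplying a cone on the right by arbitrary cones multiplies its
  function by arbitrary constants and moves its vertex arbitrarily.  Hence a principal right ideal
  consists of all cones whose function lies in a fixed left coset of the constants.\<close>

locale rees_matrix = group G for G :: "('g, 'm) monoid_scheme" (structure) +
  fixes I :: "'i set" and \<Lambda> :: "'l set" and P :: "'l \<Rightarrow> 'i \<Rightarrow> 'g"
  assumes I_nonempty: "I \<noteq> {}"
    and P_closed: "\<And>l i. l \<in> \<Lambda> \<Longrightarrow> i \<in> I \<Longrightarrow> P l i \<in> carrier G"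
begin

abbreviation "T \<equiv> TL G I \<Lambda> P"
abbreviation "H \<equiv> power_group G \<Lambda>"
abbreviation "K \<equiv> const_subgroup G \<Lambda>"
abbreviation "coords \<equiv> cone_coords G I \<Lambda>"

sublocale H: group H
  by (simp add: is_group product_group)

sublocale K: subgroup K H
  by (rule subgroup_const[OF is_group])

lemma coordsE:
  assumes "\<gamma> \<in> carrier T"
  obtains c l where "c \<in> carrier H" "l \<in> \<Lambda>" "coords \<gamma> c l"
proof -
  have "\<exists>!(c, l). c \<in> carrier H \<and> l \<in> \<Lambda> \<and> coords \<gamma> c l"
    by (rule cone_coords_ex1[OF is_group I_nonempty P_closed assms])
  then obtain p where "case p of (c, l) \<Rightarrow> c \<in> carrier H \<and> l \<in> \<Lambda> \<and> coords \<gamma> c l"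
    by (rule ex1E)
  then show thesis
    using that by (cases p) (simp only: prod.case, blast)
qed

text \<open>The relation \<open>coords\<close> constrains a function only at points of \<Lambda>.
  Membership in \<open>carrier H\<close> adds extensionality, so agreement on \<Lambda> becomes
  equality of functions.\<close>

lemma coords_unique:
  assumes "\<gamma> \<in> carrier T"
    and c: "c \<in> carrier H" "k \<in> \<Lambda>" "coords \<gamma> c k"
    and d: "d \<in> carrier H" "l \<in> \<Lambda>" "coords \<gamma> d l"
  shows "c = d"
proof -
  have "\<exists>!(c, l). c \<in> carrier H \<and> l \<in> \<Lambda> \<and> coords \<gamma> c l"
    by (rule cone_coords_ex1[OF is_group I_nonempty P_closed assms(1)])
  then obtain p where
    p: "\<forall>q. (case q of (c, l) \<Rightarrow> c \<in> carrier H \<and> l \<in> \<Lambda> \<and> coords \<gamma> c l) \<longrightarrow> q = p"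
    by (rule ex1E)
  have "(c, k) = p" "(d, l) = p"
    using p[rule_format, of "(c, k)"] p[rule_format, of "(d, l)"] c d by (simp_all only: prod.case)
  then show ?thesis by blast
qed

lemma coords_ex1:
  assumes "c \<in> carrier H" "l \<in> \<Lambda>"
  shows "\<exists>!\<gamma>. \<gamma> \<in> carrier T \<and> coords \<gamma> c l"
  by (rule cone_ex1[OF is_group I_nonempty P_closed assms])

lemma coords_mult:
  assumes "c \<in> carrier H" "k \<in> \<Lambda>" "coords \<gamma> c k" "d \<in> carrier H" "l \<in> \<Lambda>" "coords \<delta> d l"
  shows "coords (\<gamma> \<star>\<^bsub>T\<^esub> \<delta>) (c \<otimes>\<^bsub>H\<^esub> (\<lambda>_\<in>\<Lambda>. d k)) l"
  by (rule cone_coords_mult[OF is_group I_nonempty P_closed assms(1,4,2,5,3,6)])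

text \<open>\<open>TL\<close> is a bare record, so closure has to be checked. In coordinates it
  reduces to closure of G: each component of the product is again some \<open>rho\<close> with
  parameter in G.\<close>

lemma TL_mult_closed:
  assumes \<gamma>: "\<gamma> \<in> carrier T" and \<delta>: "\<delta> \<in> carrier T"
  shows "\<gamma> \<star>\<^bsub>T\<^esub> \<delta> \<in> carrier T"
proof -
  have obj: "L_obj G I \<Lambda> P = lbar G I ` \<Lambda>"
    by (rule L_obj_eq[OF is_group I_nonempty P_closed])
  obtain c k where c: "c \<in> carrier H" "k \<in> \<Lambda>" "coords \<gamma> c k"
    using \<gamma> by (rule coordsE)
  obtain d l where d: "d \<in> carrier H" "l \<in> \<Lambda>" "coords \<delta> d l"
    using \<delta> by (rule coordsE)
  let ?p = "\<gamma> \<star>\<^bsub>T\<^esub> \<delta>" and ?e = "c \<otimes>\<^bsub>H\<^esub> (\<lambda>_\<in>\<Lambda>. d k)"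
  have p: "coords ?p ?e l"
    using c d by (rule coords_mult)
  \<comment> \<open>Of the right factor only the component at the vertex of \<gamma> enters the
    product, hence the single value \<open>d k\<close>.\<close>
  have "d k \<in> carrier G" using c(2) d(1) by auto
  then have e: "?e \<mu> \<in> carrier G" if "\<mu> \<in> \<Lambda>" for \<mu>
    using c(1) that by auto
  have "component ?p \<in> (\<Pi>\<^sub>E A\<in>L_obj G I \<Lambda> P. L_hom G I \<Lambda> A (vertex ?p))"
  proof (rule PiE_I)
    fix A assume "A \<in> L_obj G I \<Lambda> P"
    then obtain \<mu> where \<mu>: "\<mu> \<in> \<Lambda>" "A = lbar G I \<mu>" using obj by blast
    have eqs: "component ?p A = rho G I \<mu> l (?e \<mu>)" "vertex ?p = lbar G I l"
      using p \<mu> unfolding cone_coords_def by blast+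
    show "component ?p A \<in> L_hom G I \<Lambda> A (vertex ?p)"
      unfolding eqs unfolding L_hom_def using \<mu> d(2) e[OF \<mu>(1)] by blast
  \<comment> \<open>The remaining goal concerns arguments outside \<open>L_obj\<close>, where the
    restriction in \<open>TL\<close> makes the component \<open>undefined\<close>.\<close>
  qed (simp add: TL_def)
  moreover have "vertex ?p \<in> L_obj G I \<Lambda> P"
    using \<delta> by (simp add: TL_def normal_cones_def)
  ultimately have "?p \<in> normal_cones G I \<Lambda> P"
    unfolding normal_cones_def by blast
  then show ?thesis by (simp only: TL_def partial_object.select_convs)
qed

text \<open>The right-hand side mentions neither \<open>k\<close> nor \<open>c\<close> itself, only
  the left coset of \<open>c\<close>: a right factor can supply any constant at \<open>k\<close> and
  any vertex \<open>m\<close>. This is what makes the coset an invariant of the ideal.\<close>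

lemma principal_right_ideal_TL:
  assumes \<gamma>: "\<gamma> \<in> carrier T" and c: "c \<in> carrier H" "k \<in> \<Lambda>" "coords \<gamma> c k"
  shows "principal_right_ideal T \<gamma> =
    {\<delta> \<in> carrier T. \<exists>d \<in> c <#\<^bsub>H\<^esub> K. \<exists>m\<in>\<Lambda>. coords \<delta> d m}" (is "?L = ?R")
proof
  show "?L \<subseteq> ?R"
  proof
    fix \<delta> assume "\<delta> \<in> ?L"
    then consider "\<delta> = \<gamma>" | \<sigma> where "\<sigma> \<in> carrier T" "\<delta> = \<gamma> \<star>\<^bsub>T\<^esub> \<sigma>"
      by (auto simp: principal_right_ideal_def)
    then show "\<delta> \<in> ?R"
    proof cases
      case 1
      \<comment> \<open>The adjoined generator is covered because the identity of \<open>H\<close>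
        is the constant function with value the identity of G.\<close>
      have "c \<otimes>\<^bsub>H\<^esub> \<one>\<^bsub>H\<^esub> \<in> c <#\<^bsub>H\<^esub> K"
        unfolding l_coset_def using K.one_closed by blast
      then have "c \<in> c <#\<^bsub>H\<^esub> K"
        by (simp only: H.r_one[OF c(1)])
      then show ?thesis using 1 \<gamma> c by blast
    next
      case 2
      obtain d l where d: "d \<in> carrier H" "l \<in> \<Lambda>" "coords \<sigma> d l"
        using 2(1) by (rule coordsE)
      have "d k \<in> carrier G" using d(1) c(2) by auto
      then have "c \<otimes>\<^bsub>H\<^esub> (\<lambda>_\<in>\<Lambda>. d k) \<in> c <#\<^bsub>H\<^esub> K"
        unfolding l_coset_def const_subgroup_def by blast
      moreover have "coords \<delta> (c \<otimes>\<^bsub>H\<^esub> (\<lambda>_\<in>\<Lambda>. d k)) l"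
        unfolding 2(2) using c d by (rule coords_mult)
      moreover have "\<delta> \<in> carrier T"
        unfolding 2(2) using \<gamma> 2(1) by (rule TL_mult_closed)
      ultimately show ?thesis using d(2) by blast
    qed
  qed
  show "?R \<subseteq> ?L"
  proof
    fix \<delta> assume "\<delta> \<in> ?R"
    then obtain g m where g: "g \<in> carrier G" and m: "m \<in> \<Lambda>"
      and \<delta>: "\<delta> \<in> carrier T" "coords \<delta> (c \<otimes>\<^bsub>H\<^esub> (\<lambda>_\<in>\<Lambda>. g)) m"
      unfolding l_coset_def const_subgroup_def by blast
    have e: "(\<lambda>_\<in>\<Lambda>. g) \<in> carrier H" using g by auto
    \<comment> \<open>The right factor is the cone with vertex \<open>m\<close> and constant
      function \<open>g\<close>; its value at \<open>k\<close> is \<open>g\<close>, whatever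
      \<open>k\<close> is.\<close>
    obtain \<sigma> where \<sigma>: "\<sigma> \<in> carrier T" "coords \<sigma> (\<lambda>_\<in>\<Lambda>. g) m"
      using coords_ex1[OF e m] by blast
    have "coords (\<gamma> \<star>\<^bsub>T\<^esub> \<sigma>) (c \<otimes>\<^bsub>H\<^esub> (\<lambda>_\<in>\<Lambda>. g)) m"
      using coords_mult[OF c e m \<sigma>(2)] unfolding restrict_apply'[OF c(2)] .
    moreover have "\<gamma> \<star>\<^bsub>T\<^esub> \<sigma> \<in> carrier T"
      using \<gamma> \<sigma>(1) by (rule TL_mult_closed)
    \<comment> \<open>Both cones have the same coordinates, and coordinates determine a
      cone.\<close>
    ultimately have "\<delta> = \<gamma> \<star>\<^bsub>T\<^esub> \<sigma>"
      using coords_ex1[OF H.m_closed[OF c(1) e] m] \<delta> by blast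
    then show "\<delta> \<in> ?L" using \<sigma>(1) by (auto simp: principal_right_ideal_def)
  qed
qed

text \<open>Equal cosets give equal ideals by the description above. Conversely, \<gamma> lies in
  the ideal of \<delta>, which puts \<open>c\<close> into the coset of \<open>d\<close>, and a left
  coset is determined by any of its elements.\<close>

lemma green_R_TL_iff:
  assumes \<gamma>: "\<gamma> \<in> carrier T" and c: "c \<in> carrier H" "k \<in> \<Lambda>" "coords \<gamma> c k"
    and \<delta>: "\<delta> \<in> carrier T" and d: "d \<in> carrier H" "l \<in> \<Lambda>" "coords \<delta> d l"
  shows "(\<gamma>, \<delta>) \<in> green_R T \<longleftrightarrow> c <#\<^bsub>H\<^esub> K = d <#\<^bsub>H\<^esub> K"
proof
  assume "c <#\<^bsub>H\<^esub> K = d <#\<^bsub>H\<^esub> K"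
  then have "principal_right_ideal T \<gamma> = principal_right_ideal T \<delta>"
    unfolding principal_right_ideal_TL[OF \<gamma> c] principal_right_ideal_TL[OF \<delta> d] by (rule arg_cong)
  then show "(\<gamma>, \<delta>) \<in> green_R T"
    unfolding green_R_def using \<gamma> \<delta> by blast
next
  assume "(\<gamma>, \<delta>) \<in> green_R T"
  \<comment> \<open>The generator belongs to its own ideal by the \<open>insert\<close> in
    \<open>principal_right_ideal\<close>.\<close>
  then have "\<gamma> \<in> principal_right_ideal T \<delta>"
    unfolding green_R_def principal_right_ideal_def by blast
  then obtain e m where e: "e \<in> d <#\<^bsub>H\<^esub> K" "m \<in> \<Lambda>" "coords \<gamma> e m"
    unfolding principal_right_ideal_TL[OF \<delta> d] by blast
  \<comment> \<open>The coset lies inside \<open>H\<close>, so \<open>e\<close> is extensional and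
    can be compared with \<open>c\<close> as coordinates of the same cone.\<close>
  have "e \<in> carrier H"
    using e(1) H.l_coset_subset_G[OF K.subset d(1)] by blast
  then have "c = e"
    using coords_unique[OF \<gamma> c _ e(2,3)] by blast
  then have "d <#\<^bsub>H\<^esub> K = c <#\<^bsub>H\<^esub> K"
    using H.l_repr_independence[OF e(1) d(1) K.subgroup_axioms] by (simp only:)
  then show "c <#\<^bsub>H\<^esub> K = d <#\<^bsub>H\<^esub> K" by (rule sym)
qed

end

theorem proposition20:
  fixes G :: "('g, 'm) monoid_scheme" and I :: "'i set" and \<Lambda> :: "'l set"
    and P :: "'l \<Rightarrow> 'i \<Rightarrow> 'g"
    and \<gamma>1 \<gamma>2 :: "('g \<times> 'i \<times> 'l) cone" and c1 c2 :: "'l \<Rightarrow> 'g" and k l :: 'l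
  assumes "group G" and "I \<noteq> {}" and "\<Lambda> \<noteq> {}"
    and "\<And>m i. m \<in> \<Lambda> \<Longrightarrow> i \<in> I \<Longrightarrow> P m i \<in> carrier G"
    and "\<gamma>1 \<in> carrier (TL G I \<Lambda> P)" and "\<gamma>2 \<in> carrier (TL G I \<Lambda> P)"
    and "c1 \<in> carrier (power_group G \<Lambda>)" and "k \<in> \<Lambda>" and "cone_coords G I \<Lambda> \<gamma>1 c1 k"
    and "c2 \<in> carrier (power_group G \<Lambda>)" and "l \<in> \<Lambda>" and "cone_coords G I \<Lambda> \<gamma>2 c2 l"
  shows "(\<gamma>1, \<gamma>2) \<in> green_R (TL G I \<Lambda> P) \<longleftrightarrow>
    c1 <#\<^bsub>power_group G \<Lambda>\<^esub> const_subgroup G \<Lambda> = c2 <#\<^bsub>power_group G \<Lambda>\<^esub> const_subgroup G \<Lambda>"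
proof -
  interpret rees_matrix G I \<Lambda> P
    by (intro rees_matrix.intro rees_matrix_axioms.intro assms(1,2)) (rule assms(4))
  show ?thesis
    using assms(5,7-9,6,10-12) by (rule green_R_TL_iff)
qed

end
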